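(* Let $\langle F_1,E_1\rangle_1$ and $\langle F_2,E_2\rangle_2$ be two weak-$^*$ sequentially complete anti-dual pairs and let $T_1:E_1\supseteq\operatorname{dom}T_1\to F_2$ and $T_2:E_2\supseteq\operatorname{dom}T_2\to F_1$ be linear operators (defined on linear subspaces) such that $$\langle T_1x_1,x_2\rangle_2=\overline{\langle T_2x_2,x_1\rangle_1},\qquad x_1\in\operatorname{dom}T_1,\ x_2\in\operatorname{dom}T_2.$$ Assume furthermore that there exist two positive operators $A_i\in\mathscr{L}(E_i,F_i)$ and constants $\alpha_i\ge 0$ $(i=1,2)$ such that $$|\langle T_1x_1,y_2\rangle_2|^2\le\alpha_1\langle A_1x_1,x_1\rangle_1\langle A_2y_2,y_2\rangle_2,\qquad x_1\in\operatorname{dom}T_1,\ y_2\in E_2,$$ $$|\langle T_2x_2,y_1\rangle_1|^2\le\alpha_2\langle A_1y_1,y_1\rangle_1\langle A_2x_2,x_2\rangle_2,\qquad x_2\in\operatorname{dom}T_2,\ y_1\in E_1.$$ Then there exists $T\in\mathscr{L}(E_1,F_2)$ such that $T_1\subseteq T$ and $T_2\subseteq T^*$ and $$|\langle Ty_1,y_2\rangle_2|^2\le\max\{\alpha_1,\alpha_2\}\cdot\langle A_1y_1,y_1\rangle_1\langle A_2y_2,y_2\rangle_2,\qquad y_1\in E_1,\ y_2\in E_2.$$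
   Context: An anti-dual pair $\langle F,E\rangle$ consists of two complex vector spaces $E,F$ together with a separating sesquilinear map $\langle\cdot,\cdot\rangle:F\times E\to\mathbb{C}$, linear in the first and conjugate linear in the second variable (separating: if $\langle f,x\rangle=0$ for all $x\in E$ then $f=0$, and if $\langle f,x\rangle=0$ for all $f\in F$ then $x=0$). The weak topology $\sigma(E,F)$ on $E$ is induced by the functionals $\langle f,\cdot\rangle$, $f\in F$, and the topology $\sigma(F,E)$ on $F$ is induced by the functionals $\langle\cdot,x\rangle$, $x\in E$. The pair is called weak-$^*$ sequentially complete if $(F,\sigma(F,E))$ is sequentially complete. For anti-dual pairs $\langle F_i,E_i\rangle_i$ and $\langle F_j,E_j\rangle_j$, $\mathscr{L}(E_i,F_j)$ denotes the set of everywhere defined linear operators $T:E_i\to F_j$ that are continuous from $\sigma(E_i,F_i)$ to $\sigma(F_j,E_j)$. The adjoint of $T\in\mathscr{L}(E_1,F_2)$ is the operator $T^*\in\mathscr{L}(E_2,F_1)$ satisfying $\langle Tx_1,x_2\rangle_2=\overline{\langle T^*x_2,x_1\rangle_1}$ for all $x_1\in E_1$, $x_2\in E_2$. An operator $A\in\mathscr{L}(E,F)$ is positive if $\langle Ax,x\rangle\ge0$ for all $x\in E$. $T_1\subseteq T$ means that $T$ extends $T_1$. *)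

theory Defs
  imports "HOL-Analysis.Analysis"
begin

text \<open>
  A complex vector space is a type of class \<^class>\<open>ab_group_add\<close> together with a scalar
  multiplication \<open>s\<close> by complex numbers satisfying \<^locale>\<open>vector_space\<close>.
  In a pair \<open>\<langle>F, E\<rangle>\<close> the space \<open>F\<close> always comes first, as in the order of the arguments
  of the pairing.
\<close>

locale anti_dual_pair =
  F: vector_space sF + E: vector_space sE
  for sF :: "complex \<Rightarrow> 'f::ab_group_add \<Rightarrow> 'f"
    and sE :: "complex \<Rightarrow> 'e::ab_group_add \<Rightarrow> 'e" +
  fixes pair :: "'f \<Rightarrow> 'e \<Rightarrow> complex"
  assumes add_left: "pair (f + g) x = pair f x + pair g x"
    and scale_left: "pair (sF c f) x = c * pair f x"
    and add_right: "pair f (x + y) = pair f x + pair f y"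
    and scale_right: "pair f (sE c x) = cnj c * pair f x"
    and separating_left: "(\<And>x. pair f x = 0) \<Longrightarrow> f = 0"
    and separating_right: "(\<And>f. pair f x = 0) \<Longrightarrow> x = 0"

text \<open>The coarsest topology on a type making every function in \<open>\<Phi>\<close> continuous.\<close>

definition induced_topology :: "('a \<Rightarrow> complex) set \<Rightarrow> 'a topology" where
  "induced_topology \<Phi> = topology_generated_by {\<phi> -` U | \<phi> U. \<phi> \<in> \<Phi> \<and> open U}"

definition weak_topology :: "('f \<Rightarrow> 'e \<Rightarrow> complex) \<Rightarrow> 'e topology"  (* sigma(E,F) *)
  where "weak_topology pair = induced_topology (range pair)"

definition weak_star_topology :: "('f \<Rightarrow> 'e \<Rightarrow> complex) \<Rightarrow> 'f topology"  (* sigma(F,E) *)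
  where "weak_star_topology pair = induced_topology (range (\<lambda>x f. pair f x))"

text \<open>Cauchy sequences and sequential completeness with respect to the translation-invariant
  uniformity of a vector topology \<open>X\<close>.\<close>

definition vector_Cauchy :: "'a::ab_group_add topology \<Rightarrow> (nat \<Rightarrow> 'a) \<Rightarrow> bool" where
  "vector_Cauchy X u \<longleftrightarrow>
     (\<forall>U. openin X U \<and> 0 \<in> U \<longrightarrow> (\<exists>N. \<forall>m\<ge>N. \<forall>n\<ge>N. u m - u n \<in> U))"

definition sequentially_complete :: "'a::ab_group_add topology \<Rightarrow> bool" where
  "sequentially_complete X \<longleftrightarrow>
     (\<forall>u. vector_Cauchy X u \<longrightarrow> (\<exists>l. limitin X u l sequentially))"

locale weak_star_seq_complete_pair = anti_dual_pair +
  assumes seq_complete: "sequentially_complete (weak_star_topology pair)"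

text \<open>\<open>cont_ops sEi pair_i sFj pair_j\<close> is the set \<open>\<L>(E\<^sub>i, F\<^sub>j)\<close>.\<close>

definition cont_ops ::
  "(complex \<Rightarrow> 'ei::ab_group_add \<Rightarrow> 'ei) \<Rightarrow> ('fi \<Rightarrow> 'ei \<Rightarrow> complex) \<Rightarrow>
   (complex \<Rightarrow> 'fj::ab_group_add \<Rightarrow> 'fj) \<Rightarrow> ('fj \<Rightarrow> 'ej \<Rightarrow> complex) \<Rightarrow> ('ei \<Rightarrow> 'fj) set"
  where "cont_ops sEi pair_i sFj pair_j =
    {T. Vector_Spaces.linear sEi sFj T \<and>
        continuous_map (weak_topology pair_i) (weak_star_topology pair_j) T}"

text \<open>The adjoint in \<open>\<L>(E\<^sub>2, F\<^sub>1)\<close> of an operator \<open>T\<close> in \<open>\<L>(E\<^sub>1, F\<^sub>2)\<close>; unspecified for other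
  \<open>T\<close>.\<close>

definition adjoint_op ::
  "(complex \<Rightarrow> 'f1::ab_group_add \<Rightarrow> 'f1) \<Rightarrow> ('f1 \<Rightarrow> 'e1 \<Rightarrow> complex) \<Rightarrow>
   (complex \<Rightarrow> 'e2::ab_group_add \<Rightarrow> 'e2) \<Rightarrow> ('f2 \<Rightarrow> 'e2 \<Rightarrow> complex) \<Rightarrow>
   ('e1 \<Rightarrow> 'f2) \<Rightarrow> 'e2 \<Rightarrow> 'f1"
  where "adjoint_op sF1 pair1 sE2 pair2 T =
    (THE S. S \<in> cont_ops sE2 pair2 sF1 pair1 \<and>
       (\<forall>x1 x2. pair2 (T x1) x2 = cnj (pair1 (S x2) x1)))"

lemma adjoint_op_eqI:
  assumes "anti_dual_pair sF1 sE1 pair1"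
    and S: "S \<in> cont_ops sE2 pair2 sF1 pair1"
    and eq: "\<And>x1 x2. pair2 (T x1) x2 = cnj (pair1 (S x2) x1)"
  shows "adjoint_op sF1 pair1 sE2 pair2 T = S"
  unfolding adjoint_op_def
proof (rule the_equality)
  show "S \<in> cont_ops sE2 pair2 sF1 pair1 \<and>
      (\<forall>x1 x2. pair2 (T x1) x2 = cnj (pair1 (S x2) x1))"
    using S eq by blast
next
  interpret anti_dual_pair sF1 sE1 pair1 by fact
  fix R assume R: "R \<in> cont_ops sE2 pair2 sF1 pair1 \<and>
      (\<forall>x1 x2. pair2 (T x1) x2 = cnj (pair1 (R x2) x1))"
  show "R = S"
  proof
    fix x2
    have "pair1 (R x2) x1 = pair1 (S x2) x1" for x1
      using R eq[of x1 x2] by (metis complex_cnj_cnj)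
    then have "pair1 (R x2 - S x2) x1 = 0" for x1
      using add_left[of "R x2 - S x2" "S x2" x1] by simp
    then show "R x2 = S x2"
      using separating_left[of "R x2 - S x2"] by simp
  qed
qed

definition positive_op :: "('f \<Rightarrow> 'e \<Rightarrow> complex) \<Rightarrow> ('e \<Rightarrow> 'f) \<Rightarrow> bool" where
  "positive_op pair A \<longleftrightarrow> (\<forall>x. pair (A x) x \<in> \<real>\<^sub>\<ge>\<^sub>0)"

text \<open>A partially defined operator is a total function together with its domain \<open>D\<close>;
  the values outside \<open>D\<close> are irrelevant.\<close>

locale partial_linear_op =
  V: vector_space sV + W: vector_space sW
  for sV :: "complex \<Rightarrow> 'v::ab_group_add \<Rightarrow> 'v"
    and sW :: "complex \<Rightarrow> 'w::ab_group_add \<Rightarrow> 'w" +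
  fixes D :: "'v set" and T :: "'v \<Rightarrow> 'w"
  assumes subspace_dom: "V.subspace D"
    and add: "x \<in> D \<Longrightarrow> y \<in> D \<Longrightarrow> T (x + y) = T x + T y"
    and scale: "x \<in> D \<Longrightarrow> T (sV c x) = sW c (T x)"

definition extends_on :: "'v set \<Rightarrow> ('v \<Rightarrow> 'w) \<Rightarrow> ('v \<Rightarrow> 'w) \<Rightarrow> bool" where
  "extends_on D T\<^sub>0 T \<longleftrightarrow> (\<forall>x\<in>D. T x = T\<^sub>0 x)"

end

theory Submission
  imports Defs
begin

text \<open>
  After replacing \<open>A\<^sub>1\<close> by \<open>max \<alpha>\<^sub>1 \<alpha>\<^sub>2 \<cdot> A\<^sub>1\<close> both bounds have constant \<open>1\<close>. If some \<open>T\<close> with the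
  required bound existed, the quadratic form
  \<open>\<langle>A\<^sub>1 y\<^sub>1, y\<^sub>1\<rangle> + 2 Re \<langle>T y\<^sub>1, y\<^sub>2\<rangle> + \<langle>A\<^sub>2 y\<^sub>2, y\<^sub>2\<rangle>\<close> would be positive on \<open>E\<^sub>1 \<times> E\<^sub>2\<close>. The data \<open>T\<^sub>1\<close>, \<open>T\<^sub>2\<close>
  determine this form on \<open>D\<^sub>1 \<times> E\<^sub>2\<close> and on \<open>E\<^sub>1 \<times> D\<^sub>2\<close>, the two bounds say that it is positive on each
  of them, and the two parts agree on \<open>K = D\<^sub>1 \<times> D\<^sub>2\<close>, where they give a semi-inner product \<open>q\<close>.
  Such a pair of forms has a canonical positive amalgam: let \<open>y\<^sub>1\<close> and \<open>y\<^sub>2\<close> interact only through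
  their orthogonal projections to the completion of \<open>(K, q)\<close>.

  In terms of operators, put \<open>R\<^sub>1 (u, v) = A\<^sub>1 u + T\<^sub>2 v \<in> F\<^sub>1\<close> and \<open>R\<^sub>2 (u, v) = T\<^sub>1 u + A\<^sub>2 v \<in> F\<^sub>2\<close>. Positivity
  of the two parts gives \<open>\<bar>\<langle>R\<^sub>i k, y\<rangle>\<bar>\<^sup>2 \<le> \<langle>A\<^sub>i y, y\<rangle> q(k, k)\<close>
  (\<open>dominated_translate\<close>), so that \<open>R\<^sub>i\<close> extends to the completion of \<open>K\<close>, and the
  amalgam is \<open>T = R\<^sub>2 R\<^sub>1\<^sup>*\<close>, with adjoint \<open>S = R\<^sub>1 R\<^sub>2\<^sup>*\<close>. The bound for \<open>T\<close> is the
  product of the bounds for \<open>R\<^sub>1\<close> and \<open>R\<^sub>2\<close>. For \<open>x \<in> D\<^sub>1\<close> the functional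
  sending \<open>k\<close> to the conjugate of \<open>\<langle>R\<^sub>1 k, x\<rangle>\<close> is represented by \<open>(x, 0) \<in> K\<close> itself, which \<open>R\<^sub>2\<close> maps to \<open>T\<^sub>1 x\<close>;
  so \<open>T\<close> extends \<open>T\<^sub>1\<close>, and likewise \<open>S\<close> extends \<open>T\<^sub>2\<close>.

  The completion itself is never formed. A vector of it is replaced by a sequence in \<open>K\<close> that
  represents a given bounded functional in the limit
  (\<open>asymptotic_representation_exists\<close>); \<open>R\<^sub>2\<close> maps this sequence to a weak-star Cauchy sequence,
  and weak-star sequential completeness provides its limit in \<open>F\<^sub>2\<close>. Linearity,
  continuity and independence of the chosen sequences all follow from the one identity
  \<open>\<langle>T y\<^sub>1, y\<^sub>2\<rangle>\<close> = conjugate of \<open>\<langle>S y\<^sub>2, y\<^sub>1\<rangle>\<close>, which comes from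
  \<open>asymptotic_representation_duality\<close>.
\<close>

section \<open>Semi-inner products on a subspace\<close>

text \<open>
  The discriminant criterion behind the Cauchy-Schwarz type estimates below: a real quadratic
  polynomial in a complex parameter \<open>t\<close> is tested at the minimiser \<open>t = - z / r\<close>.
\<close>

lemma discriminant_bound:
  fixes p r :: real and z :: complex
  assumes nonneg: "\<And>t. 0 \<le> p + 2 * Re (cnj t * z) + (cmod t)\<^sup>2 * r"
    and r: "0 \<le> r"
  shows "(cmod z)\<^sup>2 \<le> p * r"
proof (cases "r = 0")
  case True
  have "z = 0"
  proof (rule ccontr)
    assume "z \<noteq> 0"
    \<comment> \<open>Without a quadratic term, moving far in the direction of \<open>- z\<close> makes the expression negative.\<close>
    define s where "s = (\<bar>p\<bar> + 1) / (2 * (cmod z)\<^sup>2)"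
    have "Re (cnj (- of_real s * z) * z) = - s * (cmod z)\<^sup>2"
      unfolding cmod_power2 by (simp add: power2_eq_square algebra_simps)
    then have "0 \<le> p - 2 * (s * (cmod z)\<^sup>2)"
      using nonneg[of "- of_real s * z"] True by simp
    moreover have "2 * (s * (cmod z)\<^sup>2) = \<bar>p\<bar> + 1"
      using \<open>z \<noteq> 0\<close> by (simp add: s_def)
    ultimately show False
      by linarith
  qed
  then show ?thesis
    by (simp add: True)
next
  case False
  with r have r: "0 < r"
    by simp
  have 1: "Re (cnj (- z / of_real r) * z) = - (cmod z)\<^sup>2 / r"
    unfolding cmod_power2 by (simp add: power2_eq_square add_divide_distrib diff_divide_distrib)
  have 2: "(cmod (- z / of_real r))\<^sup>2 * r = (cmod z)\<^sup>2 / r"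
    using r by (simp add: norm_divide power2_eq_square field_simps)
  have "0 \<le> p - (cmod z)\<^sup>2 / r"
    using nonneg[of "- z / of_real r"] unfolding 1 2 by simp
  then show ?thesis
    using r by (simp add: field_simps)
qed

text \<open>
  The form is only controlled on the subspace \<open>K\<close>: in the application it is given on all of
  \<open>E\<^sub>1 \<times> E\<^sub>2\<close> by a formula that is additive and positive only where \<open>T\<^sub>1\<close> and \<open>T\<^sub>2\<close> are defined.
\<close>

locale semi_inner_product_on = vector_space s
  for s :: "complex \<Rightarrow> 'k::ab_group_add \<Rightarrow> 'k" +
  fixes K :: "'k set" and q :: "'k \<Rightarrow> 'k \<Rightarrow> complex"
  assumes subspace: "subspace K"
    and q_add: "x \<in> K \<Longrightarrow> y \<in> K \<Longrightarrow> z \<in> K \<Longrightarrow> q (x + y) z = q x z + q y z"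
    and q_scale: "x \<in> K \<Longrightarrow> z \<in> K \<Longrightarrow> q (s c x) z = c * q x z"
    and q_hermitian: "x \<in> K \<Longrightarrow> y \<in> K \<Longrightarrow> q y x = cnj (q x y)"
    and q_nonneg: "x \<in> K \<Longrightarrow> 0 \<le> Re (q x x)"
begin

definition seminorm :: "'k \<Rightarrow> real" where
  "seminorm x = sqrt (Re (q x x))"

lemma add_closed: "x \<in> K \<Longrightarrow> y \<in> K \<Longrightarrow> x + y \<in> K"
  using subspace subspace_add by blast

lemma diff_closed: "x \<in> K \<Longrightarrow> y \<in> K \<Longrightarrow> x - y \<in> K"
  using subspace subspace_diff by blast

lemma scale_closed: "x \<in> K \<Longrightarrow> s c x \<in> K"
  using subspace subspace_scale by blast

lemma q_diff: "x \<in> K \<Longrightarrow> y \<in> K \<Longrightarrow> z \<in> K \<Longrightarrow> q (x - y) z = q x z - q y z"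
  using q_add[of "x - y" y z] diff_closed by (simp add: algebra_simps)

lemma seminorm_nonneg: "x \<in> K \<Longrightarrow> 0 \<le> seminorm x"
  by (simp add: seminorm_def q_nonneg)

lemma seminorm_squared: "x \<in> K \<Longrightarrow> (seminorm x)\<^sup>2 = Re (q x x)"
  by (simp add: seminorm_def q_nonneg)

lemma q_perturb:
  assumes x: "x \<in> K" and k: "k \<in> K"
  shows "Re (q (x + s t k) (x + s t k))
    = Re (q x x) + 2 * Re (cnj t * q x k) + (cmod t)\<^sup>2 * Re (q k k)"
proof -
  have tk: "s t k \<in> K" and sum: "x + s t k \<in> K"
    using x k by (auto intro: add_closed scale_closed)
  have 1: "q x (s t k) = cnj t * q x k"
    using q_hermitian[OF tk x] q_hermitian[OF k x] q_scale[OF k x] by simp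
  have 2: "q (s t k) x = cnj (cnj t * q x k)"
    using q_hermitian[OF x tk] 1 by simp
  have 3: "q (s t k) (s t k) = of_real ((cmod t)\<^sup>2) * q k k"
    using q_scale[OF k tk] q_hermitian[OF tk k] q_hermitian[OF k k] q_scale[OF k k]
    by (metis (no_types, opaque_lifting) complex_cnj_mult complex_norm_square mult.assoc)
  have 4: "q x (x + s t k) = q x x + q x (s t k)"
    using q_hermitian[OF sum x] q_hermitian[OF x x] q_hermitian[OF tk x] q_add[OF x tk x] by simp
  have 5: "q (s t k) (x + s t k) = q (s t k) x + q (s t k) (s t k)"
    using q_hermitian[OF sum tk] q_hermitian[OF x tk] q_hermitian[OF tk tk] q_add[OF x tk tk]
    by simp
  show ?thesis
    using q_add[OF x tk sum] unfolding 4 5 3 1 2 by simp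
qed

text \<open>
  The sequence converges, in the Hilbert space completion of \<open>(K, q)\<close>, to the vector that
  represents the antilinear functional \<open>\<phi>\<close>: the error \<open>q (u n) - \<phi>\<close> tends to \<open>0\<close> in the dual norm.
\<close>

definition represents_asymptotically :: "(nat \<Rightarrow> 'k) \<Rightarrow> ('k \<Rightarrow> complex) \<Rightarrow> bool" where
  "represents_asymptotically u \<phi> \<longleftrightarrow> range u \<subseteq> K \<and>
    (\<exists>\<epsilon>. \<epsilon> \<longlonglongrightarrow> 0 \<and> (\<forall>n. \<forall>k\<in>K. cmod (q (u n) k - \<phi> k) \<le> \<epsilon> n * seminorm k))"

text \<open>
  A Riesz representation theorem without completeness. A representing vector would be a minimiser
  of \<open>F x = q x x - 2 Re (\<phi> x)\<close>, whose first variation at \<open>x\<close> in the direction \<open>k\<close> is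
  \<open>2 Re (q x k - \<phi> k)\<close>. At a point where \<open>F\<close> is within \<open>\<delta>\<close> of its infimum this variation cannot
  be large: \<open>\<bar>q x k - \<phi> k\<bar>\<^sup>2 \<le> \<delta> q k k\<close> by the discriminant criterion.
\<close>

lemma asymptotic_representation_exists:
  assumes add: "\<And>x y. x \<in> K \<Longrightarrow> y \<in> K \<Longrightarrow> \<phi> (x + y) = \<phi> x + \<phi> y"
    and scale: "\<And>c x. x \<in> K \<Longrightarrow> \<phi> (s c x) = cnj c * \<phi> x"
    and bound: "\<And>x. x \<in> K \<Longrightarrow> (cmod (\<phi> x))\<^sup>2 \<le> b * Re (q x x)"
    and b: "0 \<le> b"
  obtains u where "represents_asymptotically u \<phi>"
proof -
  define F where "F x = Re (q x x) - 2 * Re (\<phi> x)" for x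
  have F_lower: "- b \<le> F x" if "x \<in> K" for x
  proof -
    let ?r = "Re (q x x)"
    have "cmod (\<phi> x) \<le> sqrt (b * ?r)"
      using bound[OF that] by (simp add: real_le_rsqrt)
    also have "\<dots> \<le> (b + ?r) / 2"
      using arith_geo_mean_sqrt[OF b q_nonneg[OF that]] by simp
    finally show ?thesis
      using complex_Re_le_cmod[of "\<phi> x"] by (simp add: F_def)
  qed
  define m where "m = Inf (F ` K)"
  have bdd: "bdd_below (F ` K)"
    using F_lower by (auto intro!: bdd_belowI)
  have m_le: "m \<le> F x" if "x \<in> K" for x
    unfolding m_def using bdd that by (auto intro: cInf_lower)
  have "\<exists>x\<in>K. F x < m + inverse (real (Suc n))" for n
    unfolding m_def using cInf_lessD[of "F ` K" "Inf (F ` K) + inverse (real (Suc n))"]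
      subspace_0[OF subspace] by auto
  then obtain u where u: "u n \<in> K" "F (u n) < m + inverse (real (Suc n))" for n
    by metis
  have est: "cmod (q (u n) k - \<phi> k) \<le> sqrt (inverse (real (Suc n))) * seminorm k"
    if k: "k \<in> K" for n k
  proof -
    have "0 \<le> inverse (real (Suc n)) + 2 * Re (cnj t * (q (u n) k - \<phi> k)) + (cmod t)\<^sup>2 * Re (q k k)"
      for t
    proof -
      have "m \<le> F (u n + s t k)"
        using u(1) k by (intro m_le add_closed scale_closed)
      moreover have "\<phi> (u n + s t k) = \<phi> (u n) + cnj t * \<phi> k"
        using u(1) k add scale scale_closed by metis
      ultimately show ?thesis
        using u(2)[of n] q_perturb[OF u(1) k, of n t]
        by (simp add: F_def right_diff_distrib)
    qed
    then have "(cmod (q (u n) k - \<phi> k))\<^sup>2 \<le> inverse (real (Suc n)) * Re (q k k)"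
      by (intro discriminant_bound q_nonneg k)
    then show ?thesis
      unfolding seminorm_def real_sqrt_mult[symmetric] by (rule real_le_rsqrt)
  qed
  have "(\<lambda>n. sqrt (inverse (real (Suc n)))) \<longlonglongrightarrow> sqrt 0"
    by (intro tendsto_real_sqrt LIMSEQ_inverse_real_of_nat)
  then have "represents_asymptotically u \<phi>"
    unfolding represents_asymptotically_def using u(1) est
    by (intro conjI exI[of _ "\<lambda>n. sqrt (inverse (real (Suc n)))"]) auto
  then show thesis
    by (rule that)
qed

text \<open>
  The difference \<open>d\<close> of two terms satisfies \<open>q d d = (q (u m) d - \<phi> d) - (q (u n) d - \<phi> d)\<close>,
  which is at most the sum of the two errors times the seminorm of \<open>d\<close>.
\<close>

lemma asymptotic_representation_Cauchy:
  assumes u: "represents_asymptotically u \<phi>" and e: "0 < e"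
  shows "\<exists>N. \<forall>m\<ge>N. \<forall>n\<ge>N. seminorm (u m - u n) < e"
proof -
  obtain \<epsilon> where uK: "\<And>n. u n \<in> K" and \<epsilon>: "\<epsilon> \<longlonglongrightarrow> 0"
    and est: "\<And>n k. k \<in> K \<Longrightarrow> cmod (q (u n) k - \<phi> k) \<le> \<epsilon> n * seminorm k"
    using u unfolding represents_asymptotically_def by blast
  have le: "seminorm (u m - u n) \<le> \<bar>\<epsilon> m\<bar> + \<bar>\<epsilon> n\<bar>" for m n
  proof -
    define d where "d = u m - u n"
    have d: "d \<in> K"
      by (simp add: d_def diff_closed uK)
    have "(seminorm d)\<^sup>2 = Re (q d d)"
      by (rule seminorm_squared[OF d])
    also have "q d d = (q (u m) d - \<phi> d) - (q (u n) d - \<phi> d)"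
      using q_diff[OF uK uK d] by (simp add: d_def)
    also have "Re \<dots> \<le> cmod (q (u m) d - \<phi> d) + cmod (q (u n) d - \<phi> d)"
      by (rule order_trans[OF complex_Re_le_cmod norm_triangle_ineq4])
    also have "\<dots> \<le> \<epsilon> m * seminorm d + \<epsilon> n * seminorm d"
      by (intro add_mono est d)
    also have "\<dots> \<le> (\<bar>\<epsilon> m\<bar> + \<bar>\<epsilon> n\<bar>) * seminorm d"
      using seminorm_nonneg[OF d] by (simp add: distrib_right add_mono mult_right_mono)
    finally show ?thesis
      using seminorm_nonneg[OF d] unfolding d_def[symmetric] power2_eq_square
      by (cases "seminorm d = 0") auto
  qed
  obtain N where N: "\<And>n. n \<ge> N \<Longrightarrow> \<bar>\<epsilon> n\<bar> < e / 2"
    using \<epsilon> e LIMSEQ_D[of \<epsilon> 0 "e / 2"] by auto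
  have "seminorm (u m - u n) < e" if "m \<ge> N" "n \<ge> N" for m n
    using le[of m n] N[OF that(1)] N[OF that(2)] by linarith
  then show ?thesis
    by blast
qed

text \<open>A representing vector has the norm of the functional; here this holds up to a null sequence.\<close>

lemma asymptotic_representation_norm_bound:
  assumes u: "represents_asymptotically u \<phi>"
    and bound: "\<And>x. x \<in> K \<Longrightarrow> (cmod (\<phi> x))\<^sup>2 \<le> b * Re (q x x)"
    and b: "0 \<le> b"
  obtains \<epsilon> where "\<epsilon> \<longlonglongrightarrow> 0" "\<And>n. seminorm (u n) \<le> sqrt b + \<epsilon> n"
proof -
  obtain \<epsilon> where uK: "\<And>n. u n \<in> K" and \<epsilon>: "\<epsilon> \<longlonglongrightarrow> 0"
    and est: "\<And>n k. k \<in> K \<Longrightarrow> cmod (q (u n) k - \<phi> k) \<le> \<epsilon> n * seminorm k"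
    using u unfolding represents_asymptotically_def by blast
  have "seminorm (u n) \<le> sqrt b + \<bar>\<epsilon> n\<bar>" for n
  proof -
    have "(seminorm (u n))\<^sup>2 = Re (q (u n) (u n))"
      by (rule seminorm_squared[OF uK])
    also have "\<dots> = Re (\<phi> (u n)) + Re (q (u n) (u n) - \<phi> (u n))"
      by simp
    also have "\<dots> \<le> cmod (\<phi> (u n)) + cmod (q (u n) (u n) - \<phi> (u n))"
      by (intro add_mono complex_Re_le_cmod)
    also have "\<dots> \<le> sqrt (b * Re (q (u n) (u n))) + \<epsilon> n * seminorm (u n)"
      by (intro add_mono est uK real_le_rsqrt bound)
    also have "\<dots> = (sqrt b + \<epsilon> n) * seminorm (u n)"
      by (simp add: seminorm_def real_sqrt_mult distrib_right)
    also have "\<dots> \<le> (sqrt b + \<bar>\<epsilon> n\<bar>) * seminorm (u n)"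
      by (intro mult_right_mono seminorm_nonneg uK) simp
    finally show ?thesis
      using seminorm_nonneg[OF uK, of n] b unfolding power2_eq_square
      by (cases "seminorm (u n) = 0") auto
  qed
  moreover have "(\<lambda>n. \<bar>\<epsilon> n\<bar>) \<longlonglongrightarrow> 0"
    using \<epsilon> by (rule tendsto_rabs_zero)
  ultimately show thesis
    by (rule that[rotated])
qed

text \<open>
  Both \<open>cnj (\<psi> (u n))\<close> and \<open>\<phi> (v n)\<close> are close to \<open>q (u n) (v n)\<close>: the representing vectors of
  \<open>\<phi>\<close> and \<open>\<psi>\<close> have an inner product, and it can be computed by evaluating either functional on the
  other vector.
\<close>

lemma asymptotic_representation_duality:
  assumes u: "represents_asymptotically u \<phi>" and v: "represents_asymptotically v \<psi>"
    and \<phi>_bound: "\<And>x. x \<in> K \<Longrightarrow> (cmod (\<phi> x))\<^sup>2 \<le> b * Re (q x x)" and b: "0 \<le> b"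
    and \<psi>_bound: "\<And>x. x \<in> K \<Longrightarrow> (cmod (\<psi> x))\<^sup>2 \<le> c * Re (q x x)" and c: "0 \<le> c"
  shows "(\<lambda>n. cnj (\<psi> (u n)) - \<phi> (v n)) \<longlonglongrightarrow> 0"
proof -
  obtain \<delta> where uK: "\<And>n. u n \<in> K" and \<delta>: "\<delta> \<longlonglongrightarrow> 0"
    and u_est: "\<And>n k. k \<in> K \<Longrightarrow> cmod (q (u n) k - \<phi> k) \<le> \<delta> n * seminorm k"
    using u unfolding represents_asymptotically_def by blast
  obtain \<epsilon> where vK: "\<And>n. v n \<in> K" and \<epsilon>: "\<epsilon> \<longlonglongrightarrow> 0"
    and v_est: "\<And>n k. k \<in> K \<Longrightarrow> cmod (q (v n) k - \<psi> k) \<le> \<epsilon> n * seminorm k"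
    using v unfolding represents_asymptotically_def by blast
  obtain \<delta>' where \<delta>': "\<delta>' \<longlonglongrightarrow> 0" and u_norm: "\<And>n. seminorm (u n) \<le> sqrt b + \<delta>' n"
    using asymptotic_representation_norm_bound[OF u \<phi>_bound b] by blast
  obtain \<epsilon>' where \<epsilon>': "\<epsilon>' \<longlonglongrightarrow> 0" and v_norm: "\<And>n. seminorm (v n) \<le> sqrt c + \<epsilon>' n"
    using asymptotic_representation_norm_bound[OF v \<psi>_bound c] by blast
  have "norm (cnj (\<psi> (u n)) - \<phi> (v n))
      \<le> \<bar>\<delta> n\<bar> * (sqrt c + \<epsilon>' n) + \<bar>\<epsilon> n\<bar> * (sqrt b + \<delta>' n)" for n
  proof -
    have "cnj (\<psi> (u n)) - \<phi> (v n)
        = (q (u n) (v n) - \<phi> (v n)) - cnj (q (v n) (u n) - \<psi> (u n))"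
      using q_hermitian[OF vK uK, of n n] by simp
    also have "norm \<dots> \<le> cmod (q (u n) (v n) - \<phi> (v n)) + cmod (q (v n) (u n) - \<psi> (u n))"
      using norm_triangle_ineq4 complex_mod_cnj by metis
    also have "\<dots> \<le> \<delta> n * seminorm (v n) + \<epsilon> n * seminorm (u n)"
      by (intro add_mono u_est v_est uK vK)
    also have "\<dots> \<le> \<bar>\<delta> n\<bar> * (sqrt c + \<epsilon>' n) + \<bar>\<epsilon> n\<bar> * (sqrt b + \<delta>' n)"
      by (intro add_mono mult_mono u_norm v_norm seminorm_nonneg uK vK) auto
    finally show ?thesis .
  qed
  moreover have "(\<lambda>n. \<bar>\<delta> n\<bar> * (sqrt c + \<epsilon>' n) + \<bar>\<epsilon> n\<bar> * (sqrt b + \<delta>' n)) \<longlonglongrightarrow> 0"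
    using \<delta> \<epsilon> \<delta>' \<epsilon>' by (auto intro!: tendsto_eq_intros)
  ultimately show ?thesis
    by (rule Lim_null_comparison[OF always_eventually[rule_format]])
qed

lemma asymptotic_representation_const:
  assumes "x \<in> K" "\<And>k. k \<in> K \<Longrightarrow> q x k = \<phi> k"
  shows "represents_asymptotically (\<lambda>_. x) \<phi>"
  unfolding represents_asymptotically_def
  using assms by (intro conjI exI[of _ "\<lambda>_. 0"]) auto

end

section \<open>Weak and weak-star topologies\<close>

lemma openin_induced_vimage:
  assumes "\<phi> \<in> \<Phi>" "open U"
  shows "openin (induced_topology \<Phi>) (\<phi> -` U)"
  unfolding induced_topology_def using assms by (intro topology_generated_by_Basis) blast

lemma continuous_map_induced:
  assumes "\<Phi> \<noteq> {}" "\<And>\<phi> U. \<phi> \<in> \<Phi> \<Longrightarrow> open U \<Longrightarrow> openin X ((\<phi> \<circ> T) -` U \<inter> topspace X)"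
  shows "continuous_map X (induced_topology \<Phi>) T"
  unfolding induced_topology_def
proof (rule continuous_on_generated_topo)
  fix W assume "W \<in> {\<phi> -` U | \<phi> U. \<phi> \<in> \<Phi> \<and> open U}"
  then show "openin X (T -` W \<inter> topspace X)"
    using assms(2) by (auto simp: vimage_comp)
next
  have "UNIV \<in> {\<phi> -` U | \<phi> U. \<phi> \<in> \<Phi> \<and> open U}"
    using assms(1) by (auto intro!: exI[of _ UNIV])
  then show "T ` topspace X \<subseteq> \<Union> {\<phi> -` U | \<phi> U. \<phi> \<in> \<Phi> \<and> open U}"
    by blast
qed

lemma topspace_weak_topology: "topspace (weak_topology pair) = UNIV"
proof -
  have "openin (weak_topology pair) (pair f -` UNIV)" for f
    unfolding weak_topology_def by (rule openin_induced_vimage) auto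
  then show ?thesis
    using openin_subset by fastforce
qed

text \<open>
  Neighbourhoods of \<open>0\<close> are generated by finite intersections and arbitrary unions, so the Cauchy
  condition passes from the subbasic sets to all of them.
\<close>

lemma vector_Cauchy_weak_star:
  fixes pair :: "'f::ab_group_add \<Rightarrow> 'e \<Rightarrow> complex"
  assumes diff: "\<And>f g x. pair (f - g) x = pair f x - pair g x"
    and Cauchy: "\<And>x. Cauchy (\<lambda>n. pair (u n) x)"
  shows "vector_Cauchy (weak_star_topology pair) u"
  unfolding vector_Cauchy_def
proof (intro allI impI, elim conjE)
  fix U
  let ?S = "{\<phi> -` U | \<phi> U. \<phi> \<in> range (\<lambda>x f. pair f x) \<and> open U}"
  assume "openin (weak_star_topology pair) U" and "0 \<in> U"
  then have "generate_topology_on ?S U"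
    by (simp add: weak_star_topology_def induced_topology_def openin_topology_generated_by_iff)
  then show "\<exists>N. \<forall>m\<ge>N. \<forall>n\<ge>N. u m - u n \<in> U"
    using \<open>0 \<in> U\<close>
  proof (induction rule: generate_topology_on.induct)
    case Empty
    then show ?case by simp
  next
    case (Int a b)
    then obtain M N where "\<forall>m\<ge>M. \<forall>n\<ge>M. u m - u n \<in> a" "\<forall>m\<ge>N. \<forall>n\<ge>N. u m - u n \<in> b"
      by blast
    then show ?case
      by (intro exI[of _ "max M N"]) auto
  next
    case (UN \<U>)
    then show ?case by (meson UnionE UnionI)
  next
    case (Basis W)
    then obtain x V where W: "W = (\<lambda>f. pair f x) -` V" and V: "open V"
      by blast
    have "pair 0 x \<in> V"
      using Basis.prems W by simp
    moreover have "pair 0 x = 0"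
      using diff[of 0 0 x] by simp
    ultimately obtain e where e: "0 < e" "ball 0 e \<subseteq> V"
      using V by (metis open_contains_ball)
    obtain N where "\<forall>m\<ge>N. \<forall>n\<ge>N. dist (pair (u m) x) (pair (u n) x) < e"
      using Cauchy e(1) unfolding Cauchy_def by blast
    then show ?case
      using e(2) by (intro exI[of _ N]) (auto simp: W diff dist_norm subset_iff)
  qed
qed

context anti_dual_pair
begin

lemma pair_diff_left: "pair (f - g) x = pair f x - pair g x"
  using add_left[of "f - g" g x] by (simp add: algebra_simps)

lemma pair_eqI:
  assumes "\<And>x. pair f x = pair g x"
  shows "f = g"
  using separating_left[of "f - g"] assms by (simp add: pair_diff_left)

end

lemma (in weak_star_seq_complete_pair) pointwise_Cauchy_converges:
  assumes "\<And>x. Cauchy (\<lambda>n. pair (u n) x)"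
  obtains f where "\<And>x. (\<lambda>n. pair (u n) x) \<longlonglongrightarrow> pair f x"
proof -
  have "vector_Cauchy (weak_star_topology pair) u"
    using pair_diff_left assms by (rule vector_Cauchy_weak_star)
  then obtain f where f: "limitin (weak_star_topology pair) u f sequentially"
    using seq_complete unfolding sequentially_complete_def by blast
  have "(\<lambda>n. pair (u n) x) \<longlonglongrightarrow> pair f x" for x
  proof (rule topological_tendstoI)
    fix S :: "complex set" assume "open S" "pair f x \<in> S"
    have "openin (weak_star_topology pair) ((\<lambda>f. pair f x) -` S)"
      unfolding weak_star_topology_def using \<open>open S\<close> by (intro openin_induced_vimage) auto
    then have "eventually (\<lambda>n. u n \<in> (\<lambda>f. pair f x) -` S) sequentially"
      using f \<open>pair f x \<in> S\<close> unfolding limitin_def by blast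
    then show "eventually (\<lambda>n. pair (u n) x \<in> S) sequentially"
      by simp
  qed
  then show thesis
    by (rule that)
qed

text \<open>
  The pairing separates points, so linearity of \<open>T\<close> may be tested after pairing with some \<open>y\<close>,
  where it is linearity of \<open>x \<mapsto> cnj (pair1 (S y) x)\<close>; weak continuity of this functional is what
  continuity of \<open>T\<close> amounts to.
\<close>

lemma formal_adjoints_in_cont_ops:
  assumes P1: "anti_dual_pair sF1 sE1 pair1" and P2: "anti_dual_pair sF2 sE2 pair2"
    and adj: "\<And>x y. pair2 (T x) y = cnj (pair1 (S y) x)"
  shows "T \<in> cont_ops sE1 pair1 sF2 pair2"
proof -
  interpret P1: anti_dual_pair sF1 sE1 pair1 by (rule P1)
  interpret P2: anti_dual_pair sF2 sE2 pair2 by (rule P2)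
  have "T (x + y) = T x + T y" for x y
    by (rule P2.pair_eqI) (simp add: adj P1.add_right P2.add_left)
  moreover have "T (sE1 c x) = sF2 c (T x)" for c x
    by (rule P2.pair_eqI) (simp add: adj P1.scale_right P2.scale_left)
  ultimately have "Vector_Spaces.linear sE1 sF2 T"
    using P1.E.vector_space_axioms P2.F.vector_space_axioms
    by (simp add: Vector_Spaces.linear_iff)
  moreover have "continuous_map (weak_topology pair1) (weak_star_topology pair2) T"
    unfolding weak_star_topology_def
  proof (rule continuous_map_induced)
    fix \<phi> and U :: "complex set"
    assume "\<phi> \<in> range (\<lambda>y f. pair2 f y)" and U: "open U"
    then obtain y where \<phi>: "\<phi> = (\<lambda>f. pair2 f y)"
      by blast
    have "(\<phi> \<circ> T) -` U = pair1 (S y) -` (cnj -` U)"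
      by (auto simp: \<phi> adj)
    moreover have "open (cnj -` U)"
      using U by (intro open_vimage) (auto intro: continuous_intros)
    ultimately show "openin (weak_topology pair1) ((\<phi> \<circ> T) -` U \<inter> topspace (weak_topology pair1))"
      unfolding topspace_weak_topology unfolding weak_topology_def
      by (simp add: openin_induced_vimage)
  qed simp
  ultimately show ?thesis
    by (simp add: cont_ops_def)
qed

section \<open>Operators factored through a semi-inner product space\<close>

lemma (in semi_inner_product_on) image_of_representation_converges:
  assumes pair: "weak_star_seq_complete_pair sF sE pair"
    and R: "partial_linear_op s sF K R"
    and bound: "\<And>k y. k \<in> K \<Longrightarrow> (cmod (pair (R k) y))\<^sup>2 \<le> a y * Re (q k k)"
    and a: "\<And>y. 0 \<le> a y"
    and u: "represents_asymptotically u \<phi>"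
  obtains f where "\<And>y. (\<lambda>n. pair (R (u n)) y) \<longlonglongrightarrow> pair f y"
proof -
  interpret P: weak_star_seq_complete_pair sF sE pair by (rule pair)
  interpret R: partial_linear_op s sF K R by (rule R)
  have uK: "u n \<in> K" for n
    using u unfolding represents_asymptotically_def by blast
  have "Cauchy (\<lambda>n. pair (R (u n)) y)" for y
  proof (rule metric_CauchyI)
    fix e :: real assume e: "0 < e"
    define c where "c = sqrt (a y) + 1"
    have c: "0 < c"
      using a[of y] by (simp add: c_def add_nonneg_pos)
    obtain N where N: "\<And>m n. m \<ge> N \<Longrightarrow> n \<ge> N \<Longrightarrow> seminorm (u m - u n) < e / c"
      using asymptotic_representation_Cauchy[OF u, of "e / c"] e c by auto
    have "dist (pair (R (u m)) y) (pair (R (u n)) y) < e" if "m \<ge> N" "n \<ge> N" for m n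
    proof -
      let ?d = "u m - u n"
      have d: "?d \<in> K"
        by (simp add: diff_closed uK)
      have "R (u m) = R ?d + R (u n)"
        using R.add[OF d uK, of n] by simp
      then have "dist (pair (R (u m)) y) (pair (R (u n)) y) = cmod (pair (R ?d) y)"
        by (simp add: dist_norm P.add_left)
      also have "\<dots> \<le> sqrt (a y) * seminorm ?d"
        unfolding seminorm_def real_sqrt_mult[symmetric] by (rule real_le_rsqrt[OF bound[OF d]])
      also have "\<dots> \<le> c * seminorm ?d"
        using seminorm_nonneg[OF d] by (intro mult_right_mono) (simp_all add: c_def)
      also have "\<dots> < e"
        using N[OF that] c by (simp add: field_simps)
      finally show ?thesis .
    qed
    then show "\<exists>N. \<forall>m\<ge>N. \<forall>n\<ge>N. dist (pair (R (u m)) y) (pair (R (u n)) y) < e"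
      by blast
  qed
  then show thesis
    by (rule P.pointwise_Cauchy_converges) (rule that)
qed

text \<open>
  The sequence plays the role of the vector \<open>R\<^sup>* y\<close> of the completion of \<open>K\<close>.
\<close>

lemma (in semi_inner_product_on) asymptotic_preadjoint_exists:
  assumes pair: "anti_dual_pair sF sE pair"
    and R: "partial_linear_op s sF K R"
    and bound: "\<And>k. k \<in> K \<Longrightarrow> (cmod (pair (R k) y))\<^sup>2 \<le> b * Re (q k k)"
    and b: "0 \<le> b"
  obtains u where "represents_asymptotically u (\<lambda>k. cnj (pair (R k) y))"
proof -
  interpret P: anti_dual_pair sF sE pair by (rule pair)
  interpret R: partial_linear_op s sF K R by (rule R)
  show thesis
    by (rule asymptotic_representation_exists[of "\<lambda>k. cnj (pair (R k) y)" b])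
      (simp_all add: R.add R.scale P.add_left P.scale_left bound b that)
qed

text \<open>
  This constructs \<open>T = R\<^sub>2 R\<^sub>1\<^sup>*\<close> and its adjoint \<open>S = R\<^sub>1 R\<^sub>2\<^sup>*\<close>. The last two conclusions
  compute \<open>T y\<close> when \<open>R\<^sub>1\<^sup>* y\<close> is an actual vector of \<open>K\<close>, and likewise \<open>S z\<close>; they are what makes
  \<open>T\<close> and \<open>S\<close> extensions of given operators.
\<close>

lemma (in semi_inner_product_on) factored_operator_exists:
  assumes pair1: "weak_star_seq_complete_pair sF1 sE1 pair1"
    and pair2: "weak_star_seq_complete_pair sF2 sE2 pair2"
    and R1: "partial_linear_op s sF1 K R1" and R2: "partial_linear_op s sF2 K R2"
    and bound1: "\<And>k y. k \<in> K \<Longrightarrow> (cmod (pair1 (R1 k) y))\<^sup>2 \<le> a1 y * Re (q k k)"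
    and bound2: "\<And>k y. k \<in> K \<Longrightarrow> (cmod (pair2 (R2 k) y))\<^sup>2 \<le> a2 y * Re (q k k)"
    and a1: "\<And>y. 0 \<le> a1 y" and a2: "\<And>y. 0 \<le> a2 y"
  obtains T S where
    "T \<in> cont_ops sE1 pair1 sF2 pair2"
    "S \<in> cont_ops sE2 pair2 sF1 pair1"
    "\<And>y z. pair2 (T y) z = cnj (pair1 (S z) y)"
    "\<And>y z. (cmod (pair2 (T y) z))\<^sup>2 \<le> a1 y * a2 z"
    "\<And>y k. k \<in> K \<Longrightarrow> (\<And>l. l \<in> K \<Longrightarrow> q k l = cnj (pair1 (R1 l) y)) \<Longrightarrow> T y = R2 k"
    "\<And>z k. k \<in> K \<Longrightarrow> (\<And>l. l \<in> K \<Longrightarrow> q k l = cnj (pair2 (R2 l) z)) \<Longrightarrow> S z = R1 k"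
proof -
  interpret P1: weak_star_seq_complete_pair sF1 sE1 pair1 by (rule pair1)
  interpret P2: weak_star_seq_complete_pair sF2 sE2 pair2 by (rule pair2)
  define \<phi>1 where "\<phi>1 y k = cnj (pair1 (R1 k) y)" for y k
  define \<phi>2 where "\<phi>2 z k = cnj (pair2 (R2 k) z)" for z k
  have \<phi>1_bound: "(cmod (\<phi>1 y k))\<^sup>2 \<le> a1 y * Re (q k k)" if "k \<in> K" for y k
    using bound1[OF that] by (simp add: \<phi>1_def)
  have \<phi>2_bound: "(cmod (\<phi>2 z k))\<^sup>2 \<le> a2 z * Re (q k k)" if "k \<in> K" for z k
    using bound2[OF that] by (simp add: \<phi>2_def)

  \<comment> \<open>The possible values of \<open>T\<close> at \<open>y\<close> and of \<open>S\<close> at \<open>z\<close>. That a value depends neither on the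
    representing sequence nor on a choice follows from the duality below.\<close>
  define isT where "isT y f \<longleftrightarrow> (\<exists>u. represents_asymptotically u (\<phi>1 y) \<and>
    (\<forall>z. (\<lambda>n. pair2 (R2 (u n)) z) \<longlonglongrightarrow> pair2 f z))" for y f
  define isS where "isS z g \<longleftrightarrow> (\<exists>v. represents_asymptotically v (\<phi>2 z) \<and>
    (\<forall>y. (\<lambda>n. pair1 (R1 (v n)) y) \<longlonglongrightarrow> pair1 g y))" for z g

  have "\<exists>f. isT y f" for y
  proof -
    obtain u where u: "represents_asymptotically u (\<phi>1 y)"
      using asymptotic_preadjoint_exists[OF P1.anti_dual_pair_axioms R1 bound1 a1]
      unfolding \<phi>1_def by metis
    obtain f where "\<And>z. (\<lambda>n. pair2 (R2 (u n)) z) \<longlonglongrightarrow> pair2 f z"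
      using image_of_representation_converges[OF pair2 R2 bound2 a2 u] by blast
    with u show ?thesis
      unfolding isT_def by blast
  qed
  then obtain T where T: "isT y (T y)" for y
    by metis
  have "\<exists>g. isS z g" for z
  proof -
    obtain v where v: "represents_asymptotically v (\<phi>2 z)"
      using asymptotic_preadjoint_exists[OF P2.anti_dual_pair_axioms R2 bound2 a2]
      unfolding \<phi>2_def by metis
    obtain g where "\<And>y. (\<lambda>n. pair1 (R1 (v n)) y) \<longlonglongrightarrow> pair1 g y"
      using image_of_representation_converges[OF pair1 R1 bound1 a1 v] by blast
    with v show ?thesis
      unfolding isS_def by blast
  qed
  then obtain S where S: "isS z (S z)" for z
    by metis

  have dual: "pair2 f z = cnj (pair1 g y)" if "isT y f" "isS z g" for y z f g
  proof -
    obtain u where u: "represents_asymptotically u (\<phi>1 y)"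
      and f: "(\<lambda>n. pair2 (R2 (u n)) z) \<longlonglongrightarrow> pair2 f z"
      using \<open>isT y f\<close> unfolding isT_def by blast
    obtain v where v: "represents_asymptotically v (\<phi>2 z)"
      and g: "(\<lambda>n. pair1 (R1 (v n)) y) \<longlonglongrightarrow> pair1 g y"
      using \<open>isS z g\<close> unfolding isS_def by blast
    have "(\<lambda>n. cnj (\<phi>2 z (u n)) - \<phi>1 y (v n)) \<longlonglongrightarrow> 0"
      by (rule asymptotic_representation_duality[OF u v \<phi>1_bound a1 \<phi>2_bound a2])
    moreover have "(\<lambda>n. cnj (\<phi>2 z (u n)) - \<phi>1 y (v n)) \<longlonglongrightarrow> pair2 f z - cnj (pair1 g y)"
      unfolding \<phi>1_def \<phi>2_def using f g by (auto intro!: tendsto_intros)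
    ultimately show ?thesis
      using LIMSEQ_unique by fastforce
  qed
  have adj: "pair2 (T y) z = cnj (pair1 (S z) y)" for y z
    by (rule dual[OF T S])
  have isT_eq: "T y = f" if "isT y f" for y f
    by (rule P2.pair_eqI) (simp add: adj dual[OF that S])
  have isS_eq: "S z = g" if "isS z g" for z g
    by (rule P1.pair_eqI) (metis complex_cnj_cnj adj dual[OF T that])

  show thesis
  proof (rule that)
    show "T \<in> cont_ops sE1 pair1 sF2 pair2"
      using P1.anti_dual_pair_axioms P2.anti_dual_pair_axioms adj
      by (rule formal_adjoints_in_cont_ops)
    show "S \<in> cont_ops sE2 pair2 sF1 pair1"
      using P2.anti_dual_pair_axioms P1.anti_dual_pair_axioms
      by (rule formal_adjoints_in_cont_ops[where S = T]) (simp add: adj)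
    show "pair2 (T y) z = cnj (pair1 (S z) y)" for y z
      by (rule adj)
    show "(cmod (pair2 (T y) z))\<^sup>2 \<le> a1 y * a2 z" for y z
    proof -
      obtain u where u: "represents_asymptotically u (\<phi>1 y)"
        and lim: "(\<lambda>n. pair2 (R2 (u n)) z) \<longlonglongrightarrow> pair2 (T y) z"
        using T unfolding isT_def by blast
      have uK: "u n \<in> K" for n
        using u unfolding represents_asymptotically_def by blast
      obtain \<epsilon> where \<epsilon>: "\<epsilon> \<longlonglongrightarrow> 0" and norm: "\<And>n. seminorm (u n) \<le> sqrt (a1 y) + \<epsilon> n"
        using asymptotic_representation_norm_bound[OF u \<phi>1_bound a1] by blast
      have "cmod (pair2 (R2 (u n)) z) \<le> sqrt (a2 z) * (sqrt (a1 y) + \<epsilon> n)" for n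
      proof -
        have "cmod (pair2 (R2 (u n)) z) \<le> sqrt (a2 z) * seminorm (u n)"
          unfolding seminorm_def real_sqrt_mult[symmetric] by (rule real_le_rsqrt[OF bound2[OF uK]])
        also have "\<dots> \<le> sqrt (a2 z) * (sqrt (a1 y) + \<epsilon> n)"
          by (intro mult_left_mono norm) (simp add: a2)
        finally show ?thesis .
      qed
      moreover have "(\<lambda>n. sqrt (a2 z) * (sqrt (a1 y) + \<epsilon> n)) \<longlonglongrightarrow> sqrt (a2 z) * sqrt (a1 y)"
        using \<epsilon> by (auto intro!: tendsto_eq_intros)
      ultimately have "cmod (pair2 (T y) z) \<le> sqrt (a2 z) * sqrt (a1 y)"
        using tendsto_norm[OF lim] by (intro LIMSEQ_le) auto
      then have "(cmod (pair2 (T y) z))\<^sup>2 \<le> (sqrt (a2 z) * sqrt (a1 y))\<^sup>2"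
        by (intro power_mono) auto
      then show ?thesis
        using a1 a2 by (simp add: power_mult_distrib mult.commute)
    qed
    show "T y = R2 k" if "k \<in> K" "\<And>l. l \<in> K \<Longrightarrow> q k l = cnj (pair1 (R1 l) y)" for y k
    proof (rule isT_eq)
      have "represents_asymptotically (\<lambda>_. k) (\<phi>1 y)"
        unfolding \<phi>1_def by (rule asymptotic_representation_const[OF that])
      then show "isT y (R2 k)"
        unfolding isT_def by (intro exI[of _ "\<lambda>_. k"]) simp
    qed
    show "S z = R1 k" if "k \<in> K" "\<And>l. l \<in> K \<Longrightarrow> q k l = cnj (pair2 (R2 l) z)" for z k
    proof (rule isS_eq)
      have "represents_asymptotically (\<lambda>_. k) (\<phi>2 z)"
        unfolding \<phi>2_def by (rule asymptotic_representation_const[OF that])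
      then show "isS z (R1 k)"
        unfolding isS_def by (intro exI[of _ "\<lambda>_. k"]) simp
    qed
  qed
qed

section \<open>Positive operators\<close>

locale positive_operator = anti_dual_pair sF sE pair
  for sF :: "complex \<Rightarrow> 'f::ab_group_add \<Rightarrow> 'f" and sE :: "complex \<Rightarrow> 'e::ab_group_add \<Rightarrow> 'e"
    and pair :: "'f \<Rightarrow> 'e \<Rightarrow> complex" +
  fixes A :: "'e \<Rightarrow> 'f"
  assumes linear: "Vector_Spaces.linear sE sF A"
    and positive: "positive_op pair A"
begin

lemma A_add: "A (x + y) = A x + A y" and A_scale: "A (sE c x) = sF c (A x)"
  using linear by (simp_all add: Vector_Spaces.linear_iff)

lemma form_nonneg: "0 \<le> Re (pair (A x) x)"
  using positive by (auto simp: positive_op_def complex_nonneg_Reals_iff)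

lemma form_real: "Im (pair (A x) x) = 0"
  using positive by (auto simp: positive_op_def complex_nonneg_Reals_iff)

lemma form_perturb:
  "pair (A (x + sE t y)) (x + sE t y)
    = pair (A x) x + cnj t * pair (A x) y + t * pair (A y) x + t * cnj t * pair (A y) y"
  by (simp add: A_add A_scale add_left add_right scale_left scale_right algebra_simps)

text \<open>Polarisation: the form is real at \<open>x + y\<close> and at \<open>x + \<i> y\<close>.\<close>

lemma form_hermitian: "pair (A y) x = cnj (pair (A x) y)"
proof -
  have "Im (pair (A x) y) + Im (pair (A y) x) = 0"
    using form_real[of "x + sE 1 y"] form_real[of x] form_real[of y]
    unfolding form_perturb by simp
  moreover have "Re (pair (A y) x) - Re (pair (A x) y) = 0"
    using form_real[of "x + sE \<i> y"] form_real[of x] form_real[of y]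
    unfolding form_perturb by simp
  ultimately show ?thesis
    by (simp add: complex_eq_iff)
qed

lemma dominated_quadratic_nonneg:
  assumes "(cmod (pair g u))\<^sup>2 \<le> Re (pair (A u) u) * b" and "0 \<le> b"
  shows "0 \<le> Re (pair (A u) u) + 2 * Re (pair g u) + b"
proof -
  have "cmod (pair g u) \<le> sqrt (Re (pair (A u) u) * b)"
    using assms(1) by (rule real_le_rsqrt)
  also have "\<dots> \<le> (Re (pair (A u) u) + b) / 2"
    by (rule arith_geo_mean_sqrt[OF form_nonneg assms(2)])
  finally have "2 * cmod (pair g u) \<le> Re (pair (A u) u) + b"
    by simp
  moreover have "- Re (pair g u) \<le> cmod (pair g u)"
    using abs_Re_le_cmod[of "pair g u"] by (simp add: abs_le_iff)
  ultimately show ?thesis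
    by linarith
qed

text \<open>
  By hypothesis \<open>\<langle>A x, x\<rangle> + 2 Re \<langle>g, x\<rangle> + b\<close> is nonnegative for every \<open>x\<close>. The factor of \<open>\<langle>A y, y\<rangle>\<close> in the conclusion is the value of this
  expression at \<open>x = u\<close>, and the estimate is its discriminant along the lines \<open>x = u + t y\<close>.
\<close>

lemma dominated_translate:
  assumes g: "\<And>y. (cmod (pair g y))\<^sup>2 \<le> Re (pair (A y) y) * b" and b: "0 \<le> b"
  shows "(cmod (pair (A u + g) y))\<^sup>2
    \<le> (Re (pair (A u) u) + 2 * Re (pair g u) + b) * Re (pair (A y) y)"
proof (rule discriminant_bound[OF _ form_nonneg])
  fix t
  have "Re (t * pair (A y) u) = Re (cnj t * pair (A u) y)"
    unfolding form_hermitian[of y u] by simp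
  moreover have "Re (t * cnj t * pair (A y) y) = (cmod t)\<^sup>2 * Re (pair (A y) y)"
    unfolding complex_norm_square[symmetric] by simp
  ultimately have "Re (pair (A (u + sE t y)) (u + sE t y))
      = Re (pair (A u) u) + 2 * Re (cnj t * pair (A u) y) + (cmod t)\<^sup>2 * Re (pair (A y) y)"
    unfolding form_perturb by simp
  moreover have "pair g (u + sE t y) = pair g u + cnj t * pair g y"
    by (simp add: add_right scale_right)
  ultimately show "0 \<le> Re (pair (A u) u) + 2 * Re (pair g u) + b
      + 2 * Re (cnj t * pair (A u + g) y) + (cmod t)\<^sup>2 * Re (pair (A y) y)"
    using dominated_quadratic_nonneg[OF g b, of "u + sE t y"]
    by (simp add: add_left distrib_left)
qed

end

section \<open>Common extension of formally adjoint operators\<close>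

text \<open>
  The form \<open>q\<close> on \<open>D\<^sub>1 \<times> D\<^sub>2\<close> is the one that a common extension would induce:
  the pairing of \<open>(A\<^sub>1 u + T\<^sub>2 v, T\<^sub>1 u + A\<^sub>2 v)\<close> with the second argument. Formal adjointness of
  \<open>T\<^sub>1\<close> and \<open>T\<^sub>2\<close> is what makes it hermitian.
\<close>

lemma common_extension_normalised:
  assumes pair1: "weak_star_seq_complete_pair sF1 sE1 pair1"
    and pair2: "weak_star_seq_complete_pair sF2 sE2 pair2"
    and T1: "partial_linear_op sE1 sF2 D1 T1" and T2: "partial_linear_op sE2 sF1 D2 T2"
    and adj: "\<And>x1 x2. x1 \<in> D1 \<Longrightarrow> x2 \<in> D2 \<Longrightarrow> pair2 (T1 x1) x2 = cnj (pair1 (T2 x2) x1)"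
    and A1: "positive_operator sF1 sE1 pair1 A1" and A2: "positive_operator sF2 sE2 pair2 A2"
    and T1_bound: "\<And>x1 y2. x1 \<in> D1 \<Longrightarrow>
      (cmod (pair2 (T1 x1) y2))\<^sup>2 \<le> Re (pair1 (A1 x1) x1) * Re (pair2 (A2 y2) y2)"
    and T2_bound: "\<And>x2 y1. x2 \<in> D2 \<Longrightarrow>
      (cmod (pair1 (T2 x2) y1))\<^sup>2 \<le> Re (pair1 (A1 y1) y1) * Re (pair2 (A2 x2) x2)"
  obtains T S where
    "T \<in> cont_ops sE1 pair1 sF2 pair2" "S \<in> cont_ops sE2 pair2 sF1 pair1"
    "\<And>y1 y2. pair2 (T y1) y2 = cnj (pair1 (S y2) y1)"
    "extends_on D1 T1 T" "extends_on D2 T2 S"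
    "\<And>y1 y2. (cmod (pair2 (T y1) y2))\<^sup>2 \<le> Re (pair1 (A1 y1) y1) * Re (pair2 (A2 y2) y2)"
proof -
  interpret P1: positive_operator sF1 sE1 pair1 A1 by (rule A1)
  interpret P2: positive_operator sF2 sE2 pair2 A2 by (rule A2)
  interpret T1: partial_linear_op sE1 sF2 D1 T1 by (rule T1)
  interpret T2: partial_linear_op sE2 sF1 D2 T2 by (rule T2)
  interpret E: vector_space_prod sE1 sE2 ..
  let ?K = "D1 \<times> D2"
  define R1 where "R1 k = A1 (fst k) + T2 (snd k)" for k
  define R2 where "R2 k = A2 (snd k) + T1 (fst k)" for k
  define q where "q k l = pair1 (R1 k) (fst l) + pair2 (R2 k) (snd l)" for k l
  have R1: "partial_linear_op E.scale sF1 ?K R1"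
    by unfold_locales
      (auto simp: R1_def E.scale_def P1.A_add P1.A_scale T2.add T2.scale P1.F.scale_right_distrib
        intro: E.subspace_Times T1.subspace_dom T2.subspace_dom)
  have R2: "partial_linear_op E.scale sF2 ?K R2"
    by unfold_locales
      (auto simp: R2_def E.scale_def P2.A_add P2.A_scale T1.add T1.scale P2.F.scale_right_distrib
        intro: E.subspace_Times T1.subspace_dom T2.subspace_dom)
  interpret R1: partial_linear_op E.scale sF1 ?K R1 by (rule R1)
  interpret R2: partial_linear_op E.scale sF2 ?K R2 by (rule R2)
  \<comment> \<open>The cross term can be written with \<open>T\<^sub>2\<close> or with \<open>T\<^sub>1\<close>; the first version fits \<open>A\<^sub>1\<close> translated
    by \<open>T\<^sub>2 v\<close>, the second \<open>A\<^sub>2\<close> translated by \<open>T\<^sub>1 u\<close>.\<close>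
  have q1: "Re (q (u, v) (u, v))
      = Re (pair1 (A1 u) u) + 2 * Re (pair1 (T2 v) u) + Re (pair2 (A2 v) v)"
    and q2: "Re (q (u, v) (u, v))
      = Re (pair2 (A2 v) v) + 2 * Re (pair2 (T1 u) v) + Re (pair1 (A1 u) u)"
    if "u \<in> D1" "v \<in> D2" for u v
    using adj[OF that] by (simp_all add: q_def R1_def R2_def P1.add_left P2.add_left)
  interpret Q: semi_inner_product_on E.scale ?K q
  proof
    show "E.p.subspace ?K"
      by (rule R1.subspace_dom)
    show "q (x + y) z = q x z + q y z" if "x \<in> ?K" "y \<in> ?K" for x y z
      using that by (simp add: q_def R1.add R2.add P1.add_left P2.add_left)
    show "q (E.scale c x) z = c * q x z" if "x \<in> ?K" for c x z
      using that by (simp add: q_def R1.scale R2.scale P1.scale_left P2.scale_left distrib_left)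
    show "q y x = cnj (q x y)" if "x \<in> ?K" "y \<in> ?K" for x y
      using that adj[of "fst x" "snd y"] adj[of "fst y" "snd x"]
        P1.form_hermitian[of "fst y" "fst x"] P2.form_hermitian[of "snd y" "snd x"]
      by (auto simp: q_def R1_def R2_def P1.add_left P2.add_left)
    show "0 \<le> Re (q x x)" if "x \<in> ?K" for x
      using that q1 P1.dominated_quadratic_nonneg[OF T2_bound P2.form_nonneg] by auto
  qed
  have R1_bound: "(cmod (pair1 (R1 k) y))\<^sup>2 \<le> Re (pair1 (A1 y) y) * Re (q k k)" if "k \<in> ?K" for k y
    using that P1.dominated_translate[OF T2_bound P2.form_nonneg, of "snd k" "fst k" y] q1
    by (auto simp: R1_def mult.commute)
  have R2_bound: "(cmod (pair2 (R2 k) y))\<^sup>2 \<le> Re (pair2 (A2 y) y) * Re (q k k)" if "k \<in> ?K" for k y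
  proof -
    have "(cmod (pair2 (T1 (fst k)) z))\<^sup>2 \<le> Re (pair2 (A2 z) z) * Re (pair1 (A1 (fst k)) (fst k))" for z
      using T1_bound[of "fst k" z] that by (auto simp: mult.commute)
    from P2.dominated_translate[OF this P1.form_nonneg, of "snd k" y] show ?thesis
      using that q2 by (auto simp: R2_def mult.commute)
  qed
  have zero: "0 \<in> D1" "0 \<in> D2"
    using T1.subspace_dom T2.subspace_dom P1.E.subspace_0 P2.E.subspace_0 by auto
  have T_zero: "A1 0 = 0" "A2 0 = 0" "T1 0 = 0" "T2 0 = 0"
    using P1.A_add[of 0 0] P2.A_add[of 0 0] T1.add[OF zero(1) zero(1)] T2.add[OF zero(2) zero(2)]
    by simp_all
  obtain T S where T: "T \<in> cont_ops sE1 pair1 sF2 pair2" and S: "S \<in> cont_ops sE2 pair2 sF1 pair1"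
    and TS: "\<And>y z. pair2 (T y) z = cnj (pair1 (S z) y)"
    and bound: "\<And>y z. (cmod (pair2 (T y) z))\<^sup>2 \<le> Re (pair1 (A1 y) y) * Re (pair2 (A2 z) z)"
    and T_eq: "\<And>y k. k \<in> ?K \<Longrightarrow> (\<And>l. l \<in> ?K \<Longrightarrow> q k l = cnj (pair1 (R1 l) y)) \<Longrightarrow> T y = R2 k"
    and S_eq: "\<And>z k. k \<in> ?K \<Longrightarrow> (\<And>l. l \<in> ?K \<Longrightarrow> q k l = cnj (pair2 (R2 l) z)) \<Longrightarrow> S z = R1 k"
    using Q.factored_operator_exists[OF pair1 pair2 R1 R2 R1_bound R2_bound
        P1.form_nonneg P2.form_nonneg] by blast
  have "T x = T1 x" if x: "x \<in> D1" for x
  proof -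
    have "q (x, 0) l = cnj (pair1 (R1 l) x)" if "l \<in> ?K" for l
      using that adj[OF x, of "snd l"] P1.form_hermitian[of x "fst l"]
      by (auto simp: q_def R1_def R2_def T_zero P1.add_left)
    then show ?thesis
      using T_eq[of "(x, 0)" x] x zero by (simp add: R2_def T_zero)
  qed
  moreover have "S x = T2 x" if x: "x \<in> D2" for x
  proof -
    have "q (0, x) l = cnj (pair2 (R2 l) x)" if "l \<in> ?K" for l
      using that adj[OF _ x, of "fst l"] P2.form_hermitian[of x "snd l"]
      by (auto simp: q_def R1_def R2_def T_zero P2.add_left)
    then show ?thesis
      using S_eq[of "(0, x)" x] x zero by (simp add: R1_def T_zero)
  qed
  ultimately show thesis
    using that[OF T S TS _ _ bound] by (simp add: extends_on_def)
qed

theorem theorem3p1: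
  fixes sF1 :: "complex \<Rightarrow> 'f1::ab_group_add \<Rightarrow> 'f1"
    and sE1 :: "complex \<Rightarrow> 'e1::ab_group_add \<Rightarrow> 'e1"
    and sF2 :: "complex \<Rightarrow> 'f2::ab_group_add \<Rightarrow> 'f2"
    and sE2 :: "complex \<Rightarrow> 'e2::ab_group_add \<Rightarrow> 'e2"
    and pair1 :: "'f1 \<Rightarrow> 'e1 \<Rightarrow> complex"
    and pair2 :: "'f2 \<Rightarrow> 'e2 \<Rightarrow> complex"
    and D1 :: "'e1 set" and T1 :: "'e1 \<Rightarrow> 'f2"
    and D2 :: "'e2 set" and T2 :: "'e2 \<Rightarrow> 'f1"
    and A1 :: "'e1 \<Rightarrow> 'f1" and A2 :: "'e2 \<Rightarrow> 'f2"
    and \<alpha>1 \<alpha>2 :: real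
  assumes "weak_star_seq_complete_pair sF1 sE1 pair1"
    and "weak_star_seq_complete_pair sF2 sE2 pair2"
    and "partial_linear_op sE1 sF2 D1 T1"
    and "partial_linear_op sE2 sF1 D2 T2"
    and "\<And>x1 x2. x1 \<in> D1 \<Longrightarrow> x2 \<in> D2 \<Longrightarrow> pair2 (T1 x1) x2 = cnj (pair1 (T2 x2) x1)"
    and "A1 \<in> cont_ops sE1 pair1 sF1 pair1" and "positive_op pair1 A1"
    and "A2 \<in> cont_ops sE2 pair2 sF2 pair2" and "positive_op pair2 A2"
    and "\<alpha>1 \<ge> 0" and "\<alpha>2 \<ge> 0"
    and "\<And>x1 y2. x1 \<in> D1 \<Longrightarrow>
           (cmod (pair2 (T1 x1) y2))\<^sup>2 \<le> \<alpha>1 * Re (pair1 (A1 x1) x1) * Re (pair2 (A2 y2) y2)"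
    and "\<And>x2 y1. x2 \<in> D2 \<Longrightarrow>
           (cmod (pair1 (T2 x2) y1))\<^sup>2 \<le> \<alpha>2 * Re (pair1 (A1 y1) y1) * Re (pair2 (A2 x2) x2)"
  shows "\<exists>T \<in> cont_ops sE1 pair1 sF2 pair2.
           extends_on D1 T1 T \<and>
           extends_on D2 T2 (adjoint_op sF1 pair1 sE2 pair2 T) \<and>
           (\<forall>y1 y2. (cmod (pair2 (T y1) y2))\<^sup>2
              \<le> max \<alpha>1 \<alpha>2 * Re (pair1 (A1 y1) y1) * Re (pair2 (A2 y2) y2))"
proof -
  note pair1 = assms(1) and pair2 = assms(2) and T1 = assms(3) and T2 = assms(4) and adj = assms(5)
    and T1_bound = assms(12) and T2_bound = assms(13)
  interpret P1: weak_star_seq_complete_pair sF1 sE1 pair1 by (rule pair1)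
  interpret P2: weak_star_seq_complete_pair sF2 sE2 pair2 by (rule pair2)
  let ?\<alpha> = "max \<alpha>1 \<alpha>2"
  \<comment> \<open>Only \<open>A\<^sub>1\<close> absorbs the constant, since each bound contains \<open>A\<^sub>1\<close> exactly once.\<close>
  define A where "A x = sF1 (of_real ?\<alpha>) (A1 x)" for x
  have \<alpha>: "0 \<le> ?\<alpha>"
    using assms(10) by simp
  have A_form: "pair1 (A x) x = of_real ?\<alpha> * pair1 (A1 x) x" for x
    by (simp add: A_def P1.scale_left)
  interpret A1: positive_operator sF1 sE1 pair1 A1
    using assms(6,7) P1.anti_dual_pair_axioms
    by (simp add: positive_operator_def positive_operator_axioms_def cont_ops_def)
  interpret A2: positive_operator sF2 sE2 pair2 A2
    using assms(8,9) P2.anti_dual_pair_axioms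
    by (simp add: positive_operator_def positive_operator_axioms_def cont_ops_def)
  have A: "positive_operator sF1 sE1 pair1 A"
  proof (intro positive_operator.intro positive_operator_axioms.intro P1.anti_dual_pair_axioms)
    show "Vector_Spaces.linear sE1 sF1 A"
      using P1.E.vector_space_axioms P1.F.vector_space_axioms
      by (simp add: Vector_Spaces.linear_iff A_def A1.A_add A1.A_scale P1.F.scale_right_distrib
          mult.commute)
    show "positive_op pair1 A"
      using A1.form_nonneg A1.form_real \<alpha>
      by (simp add: positive_op_def A_form complex_nonneg_Reals_iff)
  qed
  have A_Re: "Re (pair1 (A x) x) = ?\<alpha> * Re (pair1 (A1 x) x)" for x
    by (simp add: A_form)
  have "(cmod (pair2 (T1 x) y))\<^sup>2 \<le> Re (pair1 (A x) x) * Re (pair2 (A2 y) y)" if "x \<in> D1" for x y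
    using T1_bound[OF that, of y]
    by (rule order_trans) (auto simp: A_Re intro!: mult_right_mono A1.form_nonneg A2.form_nonneg)
  moreover have "(cmod (pair1 (T2 x) y))\<^sup>2 \<le> Re (pair1 (A y) y) * Re (pair2 (A2 x) x)"
    if "x \<in> D2" for x y
    using T2_bound[OF that, of y]
    by (rule order_trans) (auto simp: A_Re intro!: mult_right_mono A1.form_nonneg A2.form_nonneg)
  ultimately obtain T S where T: "T \<in> cont_ops sE1 pair1 sF2 pair2"
    and S: "S \<in> cont_ops sE2 pair2 sF1 pair1"
    and TS: "\<And>y1 y2. pair2 (T y1) y2 = cnj (pair1 (S y2) y1)"
    and ext: "extends_on D1 T1 T" "extends_on D2 T2 S"
    and bound: "\<And>y1 y2. (cmod (pair2 (T y1) y2))\<^sup>2 \<le> Re (pair1 (A y1) y1) * Re (pair2 (A2 y2) y2)"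
    using common_extension_normalised[OF pair1 pair2 T1 T2 adj A A2.positive_operator_axioms]
    by blast
  moreover have "adjoint_op sF1 pair1 sE2 pair2 T = S"
    using P1.anti_dual_pair_axioms S TS by (rule adjoint_op_eqI)
  ultimately show ?thesis
    unfolding A_Re by auto
qed

end
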